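(* Let $(X,d)$ and $(\Lambda,\rho)$ be compact metric spaces, let $\omega:\Lambda\times X\to X$ be continuous, and fix a Borel probability measure $p$ on $\Lambda$. Suppose $\omega$ is $\mathbb{P}$-weakly hyperbolic, i.e. $\mathbb{P}(S)=1$ where $S=\{\sigma\in\Omega:\lim_{n\to\infty}\operatorname{Diam}(\omega_{\sigma_1}\circ\cdots\circ\omega_{\sigma_n}(X))=0\}$. Then for any continuous function $f:X\to\mathbb{R}$, any $x\in X$ and $\mathbb{P}$-almost every $\sigma\in\Omega$, $$\lim_{n\to\infty}\frac1n\sum_{j=1}^n f(\omega_{\sigma_j}\circ\cdots\circ\omega_{\sigma_1}(x))=\int_X f\,d\mu_p,$$ where $\mu_p$ is the unique fixed point of the operator $T_p$.
   Context: $\omega_\lambda(x)=\omega(\lambda,x)$. $\Omega=\Lambda^{\mathbb{N}}$ with the product topology and $\mathbb{P}=p^{\mathbb{N}}$ the product measure. $\operatorname{Diam}(A)=\sup\{d(x,y):x,y\in A\}$. $T_p$ acts on Borel probability measures on $X$ by $T_p(\mu)(B)=\int_\Lambda\mu(\omega_\lambda^{-1}(B))\,dp(\lambda)$; under the hypotheses it has a unique fixed point $\mu_p$. *)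

theory Defs
  imports "HOL-Probability.Probability"
begin

text \<open>Forward composition: fwd_comp w s n = w (s 0) o w (s 1) o ... o w (s (n-1)),
  i.e. omega_{sigma_1} o ... o omega_{sigma_n} with sigma_j = s (j-1).\<close>
primrec fwd_comp :: "('l \<Rightarrow> 'a \<Rightarrow> 'a) \<Rightarrow> (nat \<Rightarrow> 'l) \<Rightarrow> nat \<Rightarrow> 'a \<Rightarrow> 'a" where
  "fwd_comp w s 0 = id"
| "fwd_comp w s (Suc n) = fwd_comp w s n \<circ> w (s n)"

primrec bwd_comp :: "('l \<Rightarrow> 'a \<Rightarrow> 'a) \<Rightarrow> (nat \<Rightarrow> 'l) \<Rightarrow> nat \<Rightarrow> 'a \<Rightarrow> 'a" where
  "bwd_comp w s 0 = id"
| "bwd_comp w s (Suc n) = w (s n) \<circ> bwd_comp w s n"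

definition Omega :: "'l measure \<Rightarrow> (nat \<Rightarrow> 'l) measure" where
  "Omega p = PiM UNIV (\<lambda>_. p)"

definition Tp_fixed :: "('l \<Rightarrow> 'a::topological_space \<Rightarrow> 'a) \<Rightarrow> 'l measure \<Rightarrow> 'a measure \<Rightarrow> bool" where
  "Tp_fixed w p \<mu> \<longleftrightarrow> prob_space \<mu> \<and> sets \<mu> = sets borel \<and>
     (\<forall>B \<in> sets borel. measure \<mu> B = (\<integral>l. measure \<mu> (w l -` B) \<partial>p))"

definition mu_p :: "('l \<Rightarrow> 'a::topological_space \<Rightarrow> 'a) \<Rightarrow> 'l measure \<Rightarrow> 'a measure" where
  "mu_p w p = (THE \<mu>. Tp_fixed w p \<mu>)"

end

theory Submission
  imports Defs
begin

text \<open>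
  Fix \<open>m\<close>. The point \<open>\<omega>\<^bsub>\<sigma>(j)\<^esub> \<circ> \<dots> \<circ> \<omega>\<^bsub>\<sigma>(1)\<^esub> x\<close> lies in the range of the composition of the last \<open>m\<close>
  maps, so up to the oscillation of \<open>f\<close> on that range \<open>f\<close> there equals its value along the same \<open>m\<close>
  maps started from a fixed base point. Both the approximation and the oscillation are functions of a
  word of length \<open>m\<close>; along each residue class modulo \<open>m\<close> they form bounded i.i.d. sequences, so their
  averages converge almost surely, by Hoeffding's inequality and Borel--Cantelli. Reversing a word
  preserves its law, hence the expected oscillation is the one for the compositions in the order
  \<open>\<omega>\<^bsub>\<sigma>(1)\<^esub> \<circ> \<dots> \<circ> \<omega>\<^bsub>\<sigma>(m)\<^esub>\<close>, which tends to 0 by weak hyperbolicity and dominated convergence. The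
  same oscillation bounds the distance from the expected approximation to \<open>\<integral> f d\<mu>\<close> for every fixed
  point \<open>\<mu>\<close> of the transfer operator, which also gives uniqueness of \<open>\<mu>\<close>; existence follows by
  taking the law of the almost sure limit of \<open>\<omega>\<^bsub>\<sigma>(1)\<^esub> \<circ> \<dots> \<circ> \<omega>\<^bsub>\<sigma>(n)\<^esub> x\<close>.
\<close>

section \<open>Measurability, a strong law, and determining classes\<close>

text \<open>Total boundedness gives a finite \<open>1/(n+1)\<close>-net for each \<open>n\<close>,
  and the union of these nets is countable.\<close>

lemma compact_UNIV_dense_sequence:
  assumes "compact (UNIV :: 'a::metric_space set)"
  obtains d :: "nat \<Rightarrow> 'a::metric_space" where "\<And>x e. 0 < e \<Longrightarrow> \<exists>i. dist x (d i) < e"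
proof -
  have "\<forall>n. \<exists>k::'a set. finite k \<and> UNIV \<subseteq> (\<Union>x\<in>k. ball x (inverse (real (Suc n))))"
    using compact_imp_seq_compact[OF assms] seq_compact_imp_totally_bounded[of "UNIV :: 'a set"]
    by (metis inverse_positive_iff_positive of_nat_0_less_iff zero_less_Suc)
  then obtain k :: "nat \<Rightarrow> 'a set" where fin: "\<And>n. finite (k n)"
    and cover: "\<And>n. UNIV \<subseteq> (\<Union>x\<in>k n. ball x (inverse (real (Suc n))))"
    by metis
  define d where "d = from_nat_into (\<Union>n. k n)"
  have "\<exists>i. dist x (d i) < e" if "0 < e" for x e
  proof -
    obtain n where n: "inverse (real (Suc n)) < e"
      using reals_Archimedean[OF \<open>0 < e\<close>] by blast
    obtain y where y: "y \<in> k n" "dist y x < inverse (real (Suc n))"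
      using subsetD[OF cover[of n] UNIV_I[of x]] by auto
    have "y \<in> range d"
      using y fin unfolding d_def
      by (subst range_from_nat_into) (auto intro: uncountable_infinite countable_finite)
    then show ?thesis
      using y n by (auto simp: dist_commute intro: less_trans)
  qed
  then show ?thesis using that by blast
qed

text \<open>The argument is approximated by the countably-valued functions that replace it by the first
  sufficiently close term of a dense sequence; no second countability class is needed.\<close>

lemma measurable_continuous_parameter:
  fixes F :: "'s \<Rightarrow> 'a::metric_space \<Rightarrow> 'b::metric_space" and d :: "nat \<Rightarrow> 'a"
  assumes dense: "\<And>x e. 0 < e \<Longrightarrow> \<exists>i. dist x (d i) < e"
    and F: "\<And>x. (\<lambda>s. F s x) \<in> borel_measurable M"
    and cont: "\<And>s. continuous_on UNIV (F s)"
    and h[measurable]: "h \<in> borel_measurable M"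
  shows "(\<lambda>s. F s (h s)) \<in> borel_measurable M"
proof -
  define q where "q n s = (LEAST i. dist (h s) (d i) < inverse (real (Suc n)))" for n s
  have close: "dist (h s) (d (q n s)) < inverse (real (Suc n))" for n s
    unfolding q_def by (rule LeastI_ex) (simp add: dense)
  have dist_meas: "(\<lambda>s. dist (h s) (d i)) \<in> borel_measurable M" for i
    by (rule measurable_compose[OF h borel_measurable_continuous_onI])
       (intro continuous_intros)
  have q[measurable]: "q n \<in> measurable M (count_space UNIV)" for n
    unfolding q_def using dist_meas by measurable
  show ?thesis
  proof (rule borel_measurable_LIMSEQ_metric)
    show "(\<lambda>s. F s (d (q n s))) \<in> borel_measurable M" for n
      by (rule measurable_compose_countable[OF F q])
    fix s
    have "(\<lambda>n. dist (d (q n s)) (h s)) \<longlonglongrightarrow> 0"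
      by (rule tendsto_sandwich[OF _ _ tendsto_const LIMSEQ_inverse_real_of_nat])
         (use less_imp_le[OF close[of s]] in \<open>simp_all add: dist_commute\<close>)
    then have "(\<lambda>n. d (q n s)) \<longlonglongrightarrow> h s"
      by (rule tendsto_dist_iff[THEN iffD2])
    then show "(\<lambda>n. F s (d (q n s))) \<longlonglongrightarrow> F s (h s)"
      using cont[of s] by (auto intro: continuous_on_tendsto_compose)
  qed
qed

text \<open>Functions of overlapping windows need not be independent, so Hoeffding's inequality is
  applied to each residue class separately. Its exponential bounds are summable in \<open>n\<close>,
  Borel--Cantelli applies to each class, and the \<open>m\<close> classes are added up.\<close>

lemma (in prob_space) strong_law_bounded_mod_independent:
  fixes Y :: "nat \<Rightarrow> 'a \<Rightarrow> real"
  assumes m: "0 < m"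
    and indep: "\<And>r. r < m \<Longrightarrow> indep_vars (\<lambda>_. borel) Y {i. i mod m = r}"
    and bound: "\<And>i x. \<bar>Y i x\<bar> \<le> B"
    and mean: "\<And>i. expectation (Y i) = a"
  shows "AE x in M. (\<lambda>n. (\<Sum>i<n. Y i x) / real n) \<longlonglongrightarrow> a"
proof -
  have meas[measurable]: "Y i \<in> borel_measurable M" for i
    using indep[of "i mod m"] m unfolding indep_vars_def by auto
  \<comment> \<open>The extra 1 keeps the width \<open>2 * C\<close> of the range positive even when
    \<open>B = 0\<close>, as Hoeffding's bound divides by it.\<close>
  define C where "C = B + 1"
  have "0 \<le> B" using bound[of 0 undefined] by linarith
  then have C: "0 < C" by (simp add: C_def)
  have tail: "AE x in M. eventually (\<lambda>n. \<bar>(\<Sum>i<n. Y i x) / real n - a\<bar> < e) sequentially"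
    if e: "0 < e" for e
  proof -
    define I where "I n r = {i. i < n \<and> i mod m = r}" for n r
    \<comment> \<open>Each class is allowed the \<open>m\<close>-th part of the total deviation
      \<open>n * e\<close>.\<close>
    define A where "A n r = {x \<in> space M. \<bar>(\<Sum>i\<in>I n r. Y i x) - (\<Sum>i\<in>I n r. a)\<bar> \<ge> real n * e / real m}"
      for n r
    have [measurable]: "A n r \<in> sets M" for n r
      unfolding A_def by measurable
    \<comment> \<open>Hoeffding's exponent per unit of \<open>n\<close>, once the class size is
      bounded by \<open>n\<close>.\<close>
    define c where "c = e\<^sup>2 / (2 * (real m)\<^sup>2 * C\<^sup>2)"
    have c: "0 < c" using e m C by (simp add: c_def)
    have finI: "finite (I n r)" for n r by (simp add: I_def)
    have tail_bound: "prob (A n r) \<le> 2 * exp (- c) ^ n" if r: "r < m" and n: "0 < n" for n r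
    \<comment> \<open>For \<open>n \<le> r\<close> the class is empty and the denominator of
      Hoeffding's bound vanishes; the event is then empty because its threshold is positive.\<close>
    proof (cases "I n r = {}")
      case True
      have "0 < real n * e / real m" using n e m by simp
      then have "A n r = {}" unfolding A_def True by auto
      then show ?thesis by simp
    next
      case False
      interpret H: Hoeffding_ineq M "I n r" Y "\<lambda>_. - C" "\<lambda>_. C" "\<Sum>i\<in>I n r. a"
      proof unfold_locales
        show "indep_vars (\<lambda>_. borel) Y (I n r)"
          using indep[OF r] by (rule indep_vars_subset) (auto simp: I_def)
        show "AE x in M. Y i x \<in> {- C..C}" for i
          proof (intro always_eventually allI)
          fix x
          show "Y i x \<in> {- C..C}" using bound[of i x] unfolding C_def by auto
        qed
        show "(\<Sum>i\<in>I n r. a) \<equiv> \<Sum>i\<in>I n r. expectation (Y i)"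
          by (simp add: mean)
      qed (simp add: finI)
      have card: "0 < card (I n r)" "card (I n r) \<le> n"
        using False finI[of n r] card_mono[of "{..<n}" "I n r"] by (auto simp: I_def card_gt_0_iff)
      have s: "(\<Sum>i\<in>I n r. (C - - C)\<^sup>2) = real (card (I n r)) * (2 * C)\<^sup>2" by simp
      have "prob (A n r) \<le> 2 * exp (- 2 * (real n * e / real m)\<^sup>2 / (real (card (I n r)) * (2 * C)\<^sup>2))"
        unfolding A_def s[symmetric]
        using card C e by (intro H.Hoeffding_ineq_abs_ge) auto
      also have "\<dots> \<le> 2 * exp (- 2 * (real n * e / real m)\<^sup>2 / (real n * (2 * C)\<^sup>2))"
        using card C n by (auto intro!: divide_left_mono)
      also have "- 2 * (real n * e / real m)\<^sup>2 / (real n * (2 * C)\<^sup>2) = real n * (- c)"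
        using n m C by (simp add: c_def field_simps power2_eq_square)
      finally show ?thesis by (simp only: exp_of_nat_mult)
    qed
    have "AE x in M. eventually (\<lambda>n. x \<in> space M - A n r) sequentially" if r: "r < m" for r
    proof (rule borel_cantelli_AE1)
      show "summable (\<lambda>n. prob (A n r))"
      proof (rule summable_comparison_test_ev)
        show "eventually (\<lambda>n. norm (prob (A n r)) \<le> 2 * exp (- c) ^ n) sequentially"
          using eventually_gt_at_top[of 0] by eventually_elim (simp add: tail_bound[OF r])
        show "summable (\<lambda>n. 2 * exp (- c) ^ n)"
          using c by (intro summable_mult summable_geometric) simp
      qed
    qed (auto simp: emeasure_eq_measure)
    then have "AE x in M. \<forall>r\<in>{..<m}. eventually (\<lambda>n. x \<in> space M - A n r) sequentially"
      by (intro AE_finite_allI) auto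
    then show ?thesis
    proof (rule AE_mp, intro AE_I2 impI)
      fix x assume x: "x \<in> space M"
        and "\<forall>r\<in>{..<m}. eventually (\<lambda>n. x \<in> space M - A n r) sequentially"
      then have "eventually (\<lambda>n. \<forall>r\<in>{..<m}. x \<in> space M - A n r) sequentially"
        by (simp add: eventually_ball_finite_distrib)
      then show "eventually (\<lambda>n. \<bar>(\<Sum>i<n. Y i x) / real n - a\<bar> < e) sequentially"
        using eventually_gt_at_top[of 0]
      proof eventually_elim
        case (elim n)
        have split: "(\<Sum>r<m. \<Sum>i\<in>I n r. Y i x - a) = (\<Sum>i<n. Y i x - a)"
        proof -
          have "(\<Sum>r<m. \<Sum>i\<in>{i \<in> {..<n}. i mod m = r}. Y i x - a) = (\<Sum>i<n. Y i x - a)"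
            using m by (intro sum.group) auto
          then show ?thesis by (simp add: I_def)
        qed
        have "\<bar>\<Sum>i<n. Y i x - a\<bar> \<le> (\<Sum>r<m. \<bar>\<Sum>i\<in>I n r. Y i x - a\<bar>)"
          unfolding split[symmetric] by (rule sum_abs)
        also have "\<dots> < (\<Sum>r<m. real n * e / real m)"
        proof (rule sum_strict_mono)
          fix r assume "r \<in> {..<m}"
          then have "x \<notin> A n r" using elim by auto
          then show "\<bar>\<Sum>i\<in>I n r. Y i x - a\<bar> < real n * e / real m"
            using x unfolding A_def sum_subtractf by auto
        qed (use m in auto)
        also have "\<dots> = real n * e" using m by simp
        finally have "\<bar>(\<Sum>i<n. Y i x) - real n * a\<bar> < real n * e"
          by (simp add: sum_subtractf)
        moreover have "(\<Sum>i<n. Y i x) / real n - a = ((\<Sum>i<n. Y i x) - real n * a) / real n"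
          using elim by (simp add: field_simps)
        ultimately show ?case
          using elim by (simp add: abs_divide field_simps)
      qed
    qed
  qed
  \<comment> \<open>Restricting \<open>e\<close> to the values \<open>1/(k+1)\<close> leaves
    countably many exceptional null sets.\<close>
  have "AE x in M. \<forall>k. eventually (\<lambda>n. \<bar>(\<Sum>i<n. Y i x) / real n - a\<bar> < inverse (real (Suc k))) sequentially"
    unfolding AE_all_countable by (intro allI tail) simp
  then show ?thesis
  proof (rule AE_mp, intro AE_I2 impI)
    fix x
    assume *: "\<forall>k. eventually (\<lambda>n. \<bar>(\<Sum>i<n. Y i x) / real n - a\<bar> < inverse (real (Suc k))) sequentially"
    show "(\<lambda>n. (\<Sum>i<n. Y i x) / real n) \<longlonglongrightarrow> a"
    proof (rule tendstoI)
      fix e :: real assume "0 < e"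
      then obtain k where "inverse (real (Suc k)) < e" using reals_Archimedean by blast
      with *[rule_format, of k]
      show "eventually (\<lambda>n. dist ((\<Sum>i<n. Y i x) / real n) a < e) sequentially"
        by (auto simp: dist_real_def elim!: eventually_mono)
    qed
  qed
qed

text \<open>Passing from \<open>1..n\<close> to \<open>0..<n\<close>, and then each unit shift,
  changes the sum only at its two ends, by at most \<open>2 * K\<close>. These are
  \<open>m + 1\<close> changes, whatever \<open>n\<close> is.\<close>

lemma average_shift_diff_tendsto:
  fixes u :: "nat \<Rightarrow> real"
  assumes "\<And>j. \<bar>u j\<bar> \<le> K"
  shows "(\<lambda>n. (\<Sum>j = 1..n. u j) / real n - (\<Sum>i<n. u (i + m)) / real n) \<longlonglongrightarrow> 0"
proof (rule Lim_null_comparison)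
  have K: "0 \<le> K" using assms[of 0] by linarith
  have "\<bar>(\<Sum>j = 1..n. u j) - (\<Sum>i<n. u (i + m))\<bar> \<le> real (m + 1) * (2 * K)" for n
  proof (induction m)
    case 0
    have "(\<Sum>j = 1..n. u j) - (\<Sum>i<n. u i) = u n - u 0"
      by (induction n) (simp_all)
    then show ?case using assms[of n] assms[of 0] by (simp add: abs_le_iff)
  next
    case (Suc m)
    have "(\<Sum>i<n. u (i + Suc m)) - (\<Sum>i<n. u (i + m)) = u (n + m) - u m"
      by (induction n) simp_all
    then show ?case using Suc assms[of "n + m"] assms[of m] by (simp add: algebra_simps abs_le_iff)
  qed
  then show "eventually (\<lambda>n. norm ((\<Sum>j = 1..n. u j) / real n - (\<Sum>i<n. u (i + m)) / real n) \<le>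
      real (m + 1) * (2 * K) / real n) sequentially"
    by (simp add: divide_right_mono flip: diff_divide_distrib)
  show "(\<lambda>n. real (m + 1) * (2 * K) / real n) \<longlonglongrightarrow> 0"
    by (rule lim_const_over_n)
qed

text \<open>Closed sets form an intersection-stable generator of the Borel sets, and the indicator
  of a nonempty closed set is a pointwise limit of bounded continuous functions, so its measure is a
  limit of integrals.\<close>

lemma borel_prob_eqI_continuous_integrals:
  fixes \<mu> \<nu> :: "'a::metric_space measure"
  assumes \<mu>: "prob_space \<mu>" "sets \<mu> = sets borel" and \<nu>: "prob_space \<nu>" "sets \<nu> = sets borel"
    and eq: "\<And>f :: 'a \<Rightarrow> real. continuous_on UNIV f \<Longrightarrow> (\<And>x. \<bar>f x\<bar> \<le> 1) \<Longrightarrow>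
      (\<integral>x. f x \<partial>\<mu>) = (\<integral>x. f x \<partial>\<nu>)"
  shows "\<mu> = \<nu>"
proof (rule measure_eqI_generator_eq)
  show "Int_stable (Collect closed :: 'a set set)"
    by (auto simp: Int_stable_def)
  show "sets \<mu> = sigma_sets UNIV (Collect closed)" "sets \<nu> = sigma_sets UNIV (Collect closed)"
    using \<mu>(2) \<nu>(2) unfolding borel_eq_closed by simp_all
  show "range (\<lambda>_::nat. UNIV :: 'a set) \<subseteq> Collect closed" "(\<Union>i::nat. UNIV :: 'a set) = UNIV"
    by auto
  show "emeasure \<mu> UNIV \<noteq> \<infinity>" for i :: nat
    using \<mu>(1) by (simp add: finite_measure.emeasure_finite prob_space_def)
  fix C :: "'a set" assume "C \<in> Collect closed"
  then have C: "closed C" by simp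
  \<comment> \<open>For \<open>n > 0\<close> this is 1 on \<open>C\<close> and 0 at distance at
    least \<open>1/n\<close> from it.\<close>
  define f where "f n x = max 0 (1 - real n * infdist x C)" for n x
  have f_cont: "continuous_on UNIV (f n)" for n
    unfolding f_def by (intro continuous_intros)
  have f_bound: "\<bar>f n x\<bar> \<le> 1" for n x
    using infdist_nonneg[of x C] unfolding f_def by (auto simp: max_def)
  \<comment> \<open>\<open>infdist\<close> to the empty set is 0, so for empty \<open>C\<close>
    every \<open>f n\<close> would be constantly 1 and the limit wrong.\<close>
  have f_lim: "(\<lambda>n. f n x) \<longlonglongrightarrow> indicator C x" if "C \<noteq> {}" for x
  proof (cases "x \<in> C")
    case True
    then show ?thesis by (simp add: f_def)
  next
    case False
    then have pos: "0 < infdist x C"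
      using C that in_closed_iff_infdist_zero[of C x] infdist_nonneg[of x C] by fastforce
    obtain N where N: "1 < real N * infdist x C"
      using reals_Archimedean3[OF pos] by blast
    have "f n x = 0" if "n \<ge> N" for n
    proof -
      have "real N * infdist x C \<le> real n * infdist x C"
        using that pos by (intro mult_right_mono) auto
      then show ?thesis using N by (simp add: f_def)
    qed
    then have "eventually (\<lambda>n. f n x = 0) sequentially"
      by (auto simp: eventually_sequentially)
    then show ?thesis using False by (simp add: tendsto_eventually)
  qed
  have lim: "(\<lambda>n. \<integral>x. f n x \<partial>N) \<longlonglongrightarrow> measure N C"
    if N: "prob_space N" "sets N = sets borel" and ne: "C \<noteq> {}" for N
  proof -
    interpret prob_space N by fact
    have [measurable_cong]: "sets N = sets borel" by fact
    have [measurable]: "C \<in> sets borel" using C by simp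
    have [measurable]: "f n \<in> borel_measurable borel" for n
      by (rule borel_measurable_continuous_onI[OF f_cont])
    have "(\<lambda>n. \<integral>x. f n x \<partial>N) \<longlonglongrightarrow> (\<integral>x. indicator C x \<partial>N)"
      by (rule integral_dominated_convergence[where w="\<lambda>_. 1"])
         (auto intro!: f_lim ne simp: f_bound)
    then show ?thesis using C N(2) by (simp add: sets_eq_imp_space_eq[OF N(2)])
  qed
  show "emeasure \<mu> C = emeasure \<nu> C"
  proof (cases "C = {}")
    case False
    have "(\<lambda>n. \<integral>x. f n x \<partial>\<mu>) = (\<lambda>n. \<integral>x. f n x \<partial>\<nu>)"
      using eq[OF f_cont f_bound] by auto
    then have "measure \<mu> C = measure \<nu> C"
      using lim[OF \<mu> False] lim[OF \<nu> False] LIMSEQ_unique by metis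
    then show ?thesis
      using \<mu>(1) \<nu>(1) by (simp add: prob_space_def finite_measure.emeasure_eq_measure)
  qed simp
qed auto

section \<open>Compositions of random maps\<close>

text \<open>The first letter carries the outermost map. This links one application of the transfer
  operator to one more letter, both for existence and for iteration.\<close>

lemma fwd_comp_Suc_case_nat: "fwd_comp w (case_nat l s) (Suc n) x = w l (fwd_comp w s n x)"
  by (induction n arbitrary: x) (simp_all)

text \<open>Exhibits the orbit point at time \<open>i + m\<close> as an image under the block of the
  last \<open>m\<close> maps.\<close>

lemma bwd_comp_add: "bwd_comp w s (i + m) x = bwd_comp w (\<lambda>k. s (i + k)) m (bwd_comp w s i x)"
  by (induction m) simp_all

text \<open>Makes the ranges of the forward compositions nested, which turns shrinking diameters
  into a Cauchy property.\<close>

lemma fwd_comp_add: "fwd_comp w s (n + k) x = fwd_comp w s n (fwd_comp w (\<lambda>i. s (n + i)) k x)"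
  by (induction k arbitrary: x) simp_all

lemma fwd_comp_cong: "(\<And>k. k < n \<Longrightarrow> s k = t k) \<Longrightarrow> fwd_comp w s n = fwd_comp w t n"
  by (induction n) simp_all

lemma bwd_comp_cong: "(\<And>k. k < n \<Longrightarrow> s k = t k) \<Longrightarrow> bwd_comp w s n = bwd_comp w t n"
  by (induction n) simp_all

text \<open>The indices from \<open>n\<close> on are fixed so that this is an injection of all of
  \<open>nat\<close> and can reindex the whole product.\<close>

definition reverse_prefix :: "nat \<Rightarrow> nat \<Rightarrow> nat" where
  "reverse_prefix n i = (if i < n then n - Suc i else i)"

lemma inj_reverse_prefix: "inj (reverse_prefix n)"
  by (auto simp: inj_on_def reverse_prefix_def split: if_splits)

lemma bwd_comp_eq_fwd_comp_reverse:
  "bwd_comp w s n x = fwd_comp w (\<lambda>i. s (reverse_prefix n i)) n x"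
proof (induction n)
  case (Suc n)
  \<comment> \<open>Reversing the longer word brings \<open>s n\<close> to the front; what follows
    agrees with the reversal of the first \<open>n\<close> letters on the indices below
    \<open>n\<close>, the only ones read.\<close>
  have "(\<lambda>i. s (reverse_prefix (Suc n) i)) = case_nat (s n) (\<lambda>i. s (reverse_prefix (Suc n) (Suc i)))"
    by (auto simp: fun_eq_iff reverse_prefix_def split: nat.split)
  then have "fwd_comp w (\<lambda>i. s (reverse_prefix (Suc n) i)) (Suc n) x =
      w (s n) (fwd_comp w (\<lambda>i. s (reverse_prefix (Suc n) (Suc i))) n x)"
    by (simp only: fwd_comp_Suc_case_nat)
  also have "fwd_comp w (\<lambda>i. s (reverse_prefix (Suc n) (Suc i))) n =
      fwd_comp w (\<lambda>i. s (reverse_prefix n i)) n"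
    by (rule fwd_comp_cong) (simp add: reverse_prefix_def)
  finally show ?case using Suc by simp
qed simp

lemma distr_PiM_case_nat:
  assumes "prob_space p"
  shows "distr (p \<Otimes>\<^sub>M PiM UNIV (\<lambda>_. p)) (PiM UNIV (\<lambda>_::nat. p)) (\<lambda>(l, \<sigma>). case_nat l \<sigma>) =
    PiM UNIV (\<lambda>_. p)"
proof -
  interpret prob_space p by fact
  interpret sequence_space p ..
  show ?thesis by (rule PiM_iter)
qed

section \<open>The sequence space: measurability and laws\<close>

locale weakly_hyperbolic_ifs =
  fixes \<omega> :: "'l::metric_space \<Rightarrow> 'a::metric_space \<Rightarrow> 'a"
    and p :: "'l measure"
  assumes X_compact: "compact (UNIV :: 'a set)"
    and \<omega>_cont: "continuous_on UNIV (\<lambda>(l, x). \<omega> l x)"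
    and p_prob: "prob_space p"
    and p_borel: "sets p = sets borel"
    and weakly_hyperbolic:
      "emeasure (Omega p) {\<sigma> \<in> space (Omega p).
          (\<lambda>n. diameter (range (fwd_comp \<omega> \<sigma> n))) \<longlonglongrightarrow> 0} = 1"
begin

sublocale p: prob_space p by (fact p_prob)

sublocale P: prob_space "Omega p"
  unfolding Omega_def by (intro prob_space_PiM p_prob)

lemma sets_p [measurable_cong]: "sets p = sets borel"
  by (fact p_borel)

lemma space_p [simp]: "space p = UNIV"
  using sets_eq_imp_space_eq[OF p_borel] by simp

lemma space_Omega [simp]: "space (Omega p) = UNIV"
  by (simp add: Omega_def space_PiM)

lemma cont_param: "continuous_on UNIV (\<lambda>l. \<omega> l x)"
  using continuous_on_compose2[OF \<omega>_cont, of UNIV "\<lambda>l. (l, x)"]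
  by (simp add: continuous_intros)

lemma cont_map: "continuous_on UNIV (\<omega> l)"
  using continuous_on_compose2[OF \<omega>_cont, of UNIV "\<lambda>x. (l, x)"]
  by (simp add: continuous_intros)

lemma cont_fwd: "continuous_on UNIV (fwd_comp \<omega> s n)"
  by (induction n) (auto intro: continuous_on_compose2[OF _ cont_map] simp: id_def o_def)

lemma cont_bwd: "continuous_on UNIV (bwd_comp \<omega> s n)"
  by (induction n) (auto intro: continuous_on_compose2[OF cont_map] simp: id_def o_def)

text \<open>\<open>\<omega>\<close> is measurable in the parameter for each fixed point and
  continuous in the point for each fixed parameter, which suffices to insert a measurable point
  \<open>h t\<close>.\<close>

lemma measurable_map:
  assumes l: "l \<in> borel_measurable M" and h: "h \<in> borel_measurable M"
  shows "(\<lambda>t. \<omega> (l t) (h t)) \<in> borel_measurable M"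
proof -
  obtain d :: "nat \<Rightarrow> 'a" where d: "\<And>x e. 0 < e \<Longrightarrow> \<exists>i. dist x (d i) < e"
    using compact_UNIV_dense_sequence[OF X_compact] by blast
  have "(\<lambda>t. \<omega> (l t) x) \<in> borel_measurable M" for x
    by (rule measurable_compose[OF l borel_measurable_continuous_onI[OF cont_param]])
  from measurable_continuous_parameter[OF d this cont_map h] show ?thesis by blast
qed

lemma measurable_fwd:
  assumes "\<And>k. k < n \<Longrightarrow> (\<lambda>t. s t k) \<in> borel_measurable M" and "h \<in> borel_measurable M"
  shows "(\<lambda>t. fwd_comp \<omega> (s t) n (h t)) \<in> borel_measurable M"
  using assms
proof (induction n arbitrary: h)
  case (Suc n)
  then show ?case by (simp add: measurable_map)
qed simp

lemma measurable_bwd: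
  assumes "\<And>k. k < n \<Longrightarrow> (\<lambda>t. s t k) \<in> borel_measurable M" and "h \<in> borel_measurable M"
  shows "(\<lambda>t. bwd_comp \<omega> (s t) n (h t)) \<in> borel_measurable M"
  using assms
  by (induction n) (simp_all add: measurable_map)

lemma measurable_coordinate [measurable]: "(\<lambda>\<sigma>. \<sigma> i) \<in> borel_measurable (Omega p)"
proof -
  have "(\<lambda>\<sigma>. \<sigma> i) \<in> measurable (PiM UNIV (\<lambda>_. p)) p"
    by (rule measurable_component_singleton) simp
  also have "measurable (PiM UNIV (\<lambda>_. p)) p = borel_measurable (Omega p)"
    unfolding Omega_def by (rule measurable_cong_sets) (simp_all add: p_borel)
  finally show ?thesis .
qed

lemma measurable_into_Omega:
  assumes "\<And>i. (\<lambda>t. s t i) \<in> borel_measurable M"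
  shows "s \<in> measurable M (Omega p)"
proof -
  have "(\<lambda>t. s t i) \<in> measurable M p" for i
    using assms[of i] by (simp add: measurable_cong_sets[OF refl p_borel])
  then show ?thesis
    unfolding Omega_def by (intro measurable_PiM_single') (auto simp: space_PiM)
qed

text \<open>Distinct coordinates of an i.i.d. sequence are again i.i.d.; the shift and the reversal
  of a prefix are both of this form.\<close>

lemma distr_Omega_reindex:
  assumes "inj t"
  shows "distr (Omega p) (Omega p) (\<lambda>\<sigma> i. \<sigma> (t i)) = Omega p"
  using distr_PiM_reindex[of UNIV "\<lambda>_. p" t UNIV] assms p_prob
  by (simp add: Omega_def restrict_def)

lemma measurable_reindex: "(\<lambda>\<sigma> i. \<sigma> (t i)) \<in> measurable (Omega p) (Omega p)"
  by (rule measurable_into_Omega) simp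

lemma integral_Omega_reindex:
  fixes g :: "(nat \<Rightarrow> 'l) \<Rightarrow> real"
  assumes "inj t" and "g \<in> borel_measurable (Omega p)"
  shows "(\<integral>\<sigma>. g (\<lambda>i. \<sigma> (t i)) \<partial>Omega p) = (\<integral>\<sigma>. g \<sigma> \<partial>Omega p)"
  using integral_distr[OF measurable_reindex assms(2), of t] distr_Omega_reindex[OF assms(1)]
  by simp

lemma distr_case_nat: "distr (p \<Otimes>\<^sub>M Omega p) (Omega p) (\<lambda>(l, \<sigma>). case_nat l \<sigma>) = Omega p"
  unfolding Omega_def by (rule distr_PiM_case_nat[OF p_prob])

lemma measurable_case_nat: "(\<lambda>(l, \<sigma>). case_nat l \<sigma>) \<in> measurable (p \<Otimes>\<^sub>M Omega p) (Omega p)"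
proof (rule measurable_into_Omega)
  fix i
  have [measurable]: "fst \<in> borel_measurable (p \<Otimes>\<^sub>M Omega p)"
    using measurable_fst[of p "Omega p"] by (simp add: measurable_cong_sets[OF refl p_borel])
  show "(\<lambda>t. (case t of (l, \<sigma>) \<Rightarrow> case_nat l \<sigma>) i) \<in> borel_measurable (p \<Otimes>\<^sub>M Omega p)"
    by (cases i) (simp_all add: split_beta')
qed

lemma indep_coordinates: "P.indep_vars (\<lambda>_. borel) (\<lambda>i \<sigma>. \<sigma> i) UNIV"
proof -
  have "distr (Omega p) borel (\<lambda>\<sigma>. \<sigma> i) = p" for i
  proof -
    have "distr (Omega p) borel (\<lambda>\<sigma>. \<sigma> i) = distr (Omega p) p (\<lambda>\<sigma>. \<sigma> i)"
      by (rule distr_cong) (simp_all add: p_borel)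
    also have "\<dots> = p"
      unfolding Omega_def by (rule distr_PiM_component) (auto simp: p_prob)
    finally show ?thesis .
  qed
  moreover have "distr (Omega p) (PiM UNIV (\<lambda>_. borel)) (\<lambda>\<sigma>. \<sigma>) = Omega p"
  proof -
    have "distr (Omega p) (PiM UNIV (\<lambda>_. borel)) (\<lambda>\<sigma>. \<sigma>) = distr (Omega p) (Omega p) (\<lambda>\<sigma>. \<sigma>)"
      by (rule distr_cong) (auto simp: Omega_def p_borel intro!: sets_PiM_cong)
    then show ?thesis by simp
  qed
  ultimately show ?thesis
    by (subst P.indep_vars_iff_distr_eq_PiM) (simp_all add: Omega_def[symmetric] restrict_def)
qed

section \<open>Fixed points of the transfer operator\<close>

lemma measurable_map_pair:
  assumes "sets \<mu> = sets borel"
  shows "(\<lambda>z. \<omega> (fst z) (snd z)) \<in> borel_measurable (p \<Otimes>\<^sub>M \<mu>)"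
proof (rule measurable_map)
  show "fst \<in> borel_measurable (p \<Otimes>\<^sub>M \<mu>)"
    using measurable_fst[of p \<mu>] by (simp add: measurable_cong_sets[OF refl p_borel])
  show "snd \<in> borel_measurable (p \<Otimes>\<^sub>M \<mu>)"
    using measurable_snd[of p \<mu>] by (simp add: measurable_cong_sets[OF refl assms])
qed

text \<open>The push-forward is \<open>T_p(\<mu>)\<close>, by Fubini applied to indicators. In this
  form invariance can be used inside integrals and for laws of random points.\<close>

lemma Tp_fixed_iff_distr:
  "Tp_fixed \<omega> p \<mu> \<longleftrightarrow> prob_space \<mu> \<and> sets \<mu> = sets borel \<and>
    distr (p \<Otimes>\<^sub>M \<mu>) borel (\<lambda>z. \<omega> (fst z) (snd z)) = \<mu>"
proof -
  have "(\<forall>B \<in> sets borel. measure \<mu> B = (\<integral>l. measure \<mu> (\<omega> l -` B) \<partial>p)) \<longleftrightarrow>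
      distr (p \<Otimes>\<^sub>M \<mu>) borel (\<lambda>z. \<omega> (fst z) (snd z)) = \<mu>" (is "_ \<longleftrightarrow> ?D = \<mu>")
    if prob: "prob_space \<mu>" and sets: "sets \<mu> = sets borel"
  proof -
    interpret \<mu>: prob_space \<mu> by fact
    interpret p\<mu>: pair_prob_space p \<mu> ..
    note W = measurable_map_pair[OF sets]
    interpret D: prob_space ?D by (rule p\<mu>.prob_space_distr[OF W])
    have space: "space \<mu> = UNIV" using sets_eq_imp_space_eq[OF sets] by simp
    have D_eq: "measure ?D B = (\<integral>l. measure \<mu> (\<omega> l -` B) \<partial>p)" if B: "B \<in> sets borel" for B
    proof -
      have [measurable]: "(\<lambda>z. indicator B (\<omega> (fst z) (snd z)) :: real) \<in> borel_measurable (p \<Otimes>\<^sub>M \<mu>)"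
        by (rule measurable_compose[OF W]) (use B in simp)
      have int: "integrable (p \<Otimes>\<^sub>M \<mu>) (\<lambda>z. indicator B (\<omega> (fst z) (snd z)) :: real)"
        by (rule p\<mu>.integrable_const_bound[where B=1]) auto
      have "measure ?D B = (\<integral>z. indicator B z \<partial>?D)"
        using B by simp
      also have "\<dots> = (\<integral>z. indicator B (\<omega> (fst z) (snd z)) \<partial>(p \<Otimes>\<^sub>M \<mu>))"
        by (rule integral_distr[OF W]) (use B in simp)
      also have "\<dots> = (\<integral>l. \<integral>x. indicator B (\<omega> l x) \<partial>\<mu> \<partial>p)"
        using p\<mu>.integral_fst'[OF int] by simp
      also have "\<dots> = (\<integral>l. measure \<mu> (\<omega> l -` B) \<partial>p)"
      proof (rule Bochner_Integration.integral_cong[OF refl])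
        fix l
        have "\<omega> l -` B \<in> sets \<mu>"
          using measurable_sets[OF borel_measurable_continuous_onI[OF cont_map] B] sets by simp
        moreover have "(\<lambda>x. indicator B (\<omega> l x)) = (indicator (\<omega> l -` B) :: 'a \<Rightarrow> real)"
          by (auto simp: indicator_def)
        ultimately show "(\<integral>x. indicator B (\<omega> l x) \<partial>\<mu>) = measure \<mu> (\<omega> l -` B)"
          by (simp add: space)
      qed
      finally show ?thesis .
    qed
    show ?thesis
    proof
      assume *: "\<forall>B \<in> sets borel. measure \<mu> B = (\<integral>l. measure \<mu> (\<omega> l -` B) \<partial>p)"
      show "?D = \<mu>"
        by (rule measure_eqI) (simp_all add: sets D.emeasure_eq_measure \<mu>.emeasure_eq_measure D_eq *)
    next
      assume "?D = \<mu>"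
      then show "\<forall>B \<in> sets borel. measure \<mu> B = (\<integral>l. measure \<mu> (\<omega> l -` B) \<partial>p)"
        using D_eq by simp
    qed
  qed
  then show ?thesis unfolding Tp_fixed_def by blast
qed

section \<open>Iterating the transfer operator\<close>

lemma continuous_bounded:
  fixes f :: "'a \<Rightarrow> real"
  assumes "continuous_on UNIV f"
  obtains B where "\<And>x. \<bar>f x\<bar> \<le> B"
proof -
  have "bounded (range f)"
    by (rule compact_imp_bounded[OF compact_continuous_image[OF assms X_compact]])
  then show ?thesis using that unfolding bounded_iff by auto
qed

lemma integrable_fwd:
  fixes f :: "'a \<Rightarrow> real"
  assumes prob: "prob_space \<mu>" and sets: "sets \<mu> = sets borel" and f: "continuous_on UNIV f"
  shows "integrable \<mu> (\<lambda>x. f (fwd_comp \<omega> \<sigma> n x))"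
proof -
  interpret prob_space \<mu> by fact
  obtain B where B: "\<And>x. \<bar>f x\<bar> \<le> B" using continuous_bounded[OF f] by blast
  show ?thesis
  proof (rule integrable_const_bound[where B=B])
    show "(\<lambda>x. f (fwd_comp \<omega> \<sigma> n x)) \<in> borel_measurable \<mu>"
      using borel_measurable_continuous_onI[OF continuous_on_compose2[OF f cont_fwd]]
        measurable_cong_sets[OF sets refl] by auto
  qed (simp add: B)
qed

lemma measurable_integral_fwd:
  fixes f :: "'a \<Rightarrow> real"
  assumes prob: "prob_space \<mu>" and sets: "sets \<mu> = sets borel" and f: "continuous_on UNIV f"
  shows "(\<lambda>\<sigma>. \<integral>x. f (fwd_comp \<omega> \<sigma> n x) \<partial>\<mu>) \<in> borel_measurable (Omega p)"
proof -
  interpret \<mu>: prob_space \<mu> by fact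
  have "(\<lambda>z. f (fwd_comp \<omega> (fst z) n (snd z))) \<in> borel_measurable (Omega p \<Otimes>\<^sub>M \<mu>)"
  proof (rule measurable_compose[OF measurable_fwd])
    show "(\<lambda>z. fst z k) \<in> borel_measurable (Omega p \<Otimes>\<^sub>M \<mu>)" for k
      by measurable
    show "snd \<in> borel_measurable (Omega p \<Otimes>\<^sub>M \<mu>)"
      using measurable_snd[of "Omega p" \<mu>] by (simp add: measurable_cong_sets[OF refl sets])
  qed (rule borel_measurable_continuous_onI[OF f])
  then show ?thesis
    using \<mu>.borel_measurable_lebesgue_integral[of "\<lambda>\<sigma> x. f (fwd_comp \<omega> \<sigma> n x)" "Omega p"]
    by (simp add: split_beta')
qed

text \<open>Invariance iterated \<open>n\<close> times: one step draws an outermost letter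
  \<open>l\<close>, the induction hypothesis for \<open>f \<circ> \<omega> l\<close> draws the
  others, and \<open>l\<close> followed by them is again a sequence with law
  \<open>Omega p\<close>.\<close>

lemma Tp_fixed_integral_fwd:
  fixes f :: "'a \<Rightarrow> real"
  assumes \<mu>: "Tp_fixed \<omega> p \<mu>" and f: "continuous_on UNIV f"
  shows "(\<integral>x. f x \<partial>\<mu>) = (\<integral>\<sigma>. \<integral>x. f (fwd_comp \<omega> \<sigma> n x) \<partial>\<mu> \<partial>Omega p)"
  using f
proof (induction n arbitrary: f)
  case 0
  then show ?case by (simp add: P.prob_space[simplified])
next
  case (Suc n)
  have \<mu>_prob: "prob_space \<mu>" and sets: "sets \<mu> = sets borel"
    and D: "distr (p \<Otimes>\<^sub>M \<mu>) borel (\<lambda>z. \<omega> (fst z) (snd z)) = \<mu>"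
    using \<mu> by (auto simp: Tp_fixed_iff_distr)
  interpret \<mu>: prob_space \<mu> by fact
  interpret p\<mu>: pair_prob_space p \<mu> ..
  interpret pP: pair_prob_space p "Omega p" ..
  obtain B where B: "\<And>x. \<bar>f x\<bar> \<le> B" using continuous_bounded[OF Suc.prems] by blast
  have [measurable]: "f \<in> borel_measurable borel"
    by (rule borel_measurable_continuous_onI[OF Suc.prems])
  note W [measurable] = measurable_map_pair[OF sets]
  define H where "H \<sigma> = (\<integral>x. f (fwd_comp \<omega> \<sigma> (Suc n) x) \<partial>\<mu>)" for \<sigma>
  have H_bound: "\<bar>H \<sigma>\<bar> \<le> B" for \<sigma>
  proof -
    have int: "integrable \<mu> (\<lambda>x. f (fwd_comp \<omega> \<sigma> (Suc n) x))"
      by (rule integrable_fwd[OF \<mu>_prob sets Suc.prems])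
    have "norm (H \<sigma>) \<le> (\<integral>x. norm (f (fwd_comp \<omega> \<sigma> (Suc n) x)) \<partial>\<mu>)"
      unfolding H_def by (rule integral_norm_bound)
    also have "\<dots> \<le> B"
      using int by (intro \<mu>.integral_le_const) (auto simp: B simp del: fwd_comp.simps)
    finally show ?thesis by simp
  qed
  have H_meas: "H \<in> borel_measurable (Omega p)"
    unfolding H_def by (rule measurable_integral_fwd[OF \<mu>_prob sets Suc.prems])
  have HC_meas: "(\<lambda>z. H (case z of (l, \<sigma>) \<Rightarrow> case_nat l \<sigma>)) \<in> borel_measurable (p \<Otimes>\<^sub>M Omega p)"
    by (rule measurable_compose[OF measurable_case_nat H_meas])
  have HC_int: "integrable (p \<Otimes>\<^sub>M Omega p) (\<lambda>z. H (case z of (l, \<sigma>) \<Rightarrow> case_nat l \<sigma>))"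
    by (rule pP.integrable_const_bound[where B=B]) (auto simp: H_bound HC_meas)
  have int: "integrable (p \<Otimes>\<^sub>M \<mu>) (\<lambda>z. f (\<omega> (fst z) (snd z)))"
    by (rule p\<mu>.integrable_const_bound[where B=B]) (auto simp: B)
  have "(\<integral>x. f x \<partial>\<mu>) = (\<integral>x. f x \<partial>distr (p \<Otimes>\<^sub>M \<mu>) borel (\<lambda>z. \<omega> (fst z) (snd z)))"
    by (simp only: D)
  also have "\<dots> = (\<integral>z. f (\<omega> (fst z) (snd z)) \<partial>(p \<Otimes>\<^sub>M \<mu>))"
    by (rule integral_distr) measurable
  also have "\<dots> = (\<integral>l. \<integral>x. f (\<omega> l x) \<partial>\<mu> \<partial>p)"
    using p\<mu>.integral_fst'[OF int] by simp
  also have "\<dots> = (\<integral>l. \<integral>\<sigma>. \<integral>x. f (\<omega> l (fwd_comp \<omega> \<sigma> n x)) \<partial>\<mu> \<partial>Omega p \<partial>p)"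
    by (intro Bochner_Integration.integral_cong refl Suc.IH continuous_on_compose2[OF Suc.prems cont_map]) auto
  also have "\<dots> = (\<integral>l. \<integral>\<sigma>. H (case (l, \<sigma>) of (l, \<sigma>) \<Rightarrow> case_nat l \<sigma>) \<partial>Omega p \<partial>p)"
    unfolding H_def fwd_comp_Suc_case_nat prod.case ..
  also have "\<dots> = (\<integral>z. H (case z of (l, \<sigma>) \<Rightarrow> case_nat l \<sigma>) \<partial>(p \<Otimes>\<^sub>M Omega p))"
    by (rule pP.integral_fst'[OF HC_int])
  also have "\<dots> = (\<integral>\<sigma>. H \<sigma> \<partial>distr (p \<Otimes>\<^sub>M Omega p) (Omega p) (\<lambda>(l, \<sigma>). case_nat l \<sigma>))"
    by (rule integral_distr[OF measurable_case_nat H_meas, symmetric])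
  also have "\<dots> = (\<integral>\<sigma>. H \<sigma> \<partial>Omega p)"
    by (simp only: distr_case_nat)
  finally show ?case unfolding H_def .
qed

section \<open>Contracting sequences and existence of a fixed point\<close>

definition contracting :: "(nat \<Rightarrow> 'l) set" where
  "contracting = {\<sigma>. (\<lambda>n. diameter (range (fwd_comp \<omega> \<sigma> n))) \<longlonglongrightarrow> 0}"

text \<open>A set outside the sigma-algebra has \<open>emeasure\<close> 0, so the assumed value 1
  forces measurability.\<close>

lemma contracting_measurable: "contracting \<in> sets (Omega p)"
  using weakly_hyperbolic emeasure_notin_sets[of contracting "Omega p"]
  unfolding contracting_def by fastforce

lemma AE_contracting: "AE \<sigma> in Omega p. \<sigma> \<in> contracting"
  using weakly_hyperbolic contracting_measurable
  by (subst P.AE_in_set_eq_1) (simp_all add: contracting_def measure_def)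

lemma contracting_dist:
  assumes "\<sigma> \<in> contracting" and "0 < e"
  obtains N where "\<And>n x y. N \<le> n \<Longrightarrow> dist (fwd_comp \<omega> \<sigma> n x) (fwd_comp \<omega> \<sigma> n y) < e"
proof -
  have "eventually (\<lambda>n. diameter (range (fwd_comp \<omega> \<sigma> n)) < e) sequentially"
    using assms by (auto simp: contracting_def intro: order_tendstoD)
  then obtain N where N: "\<And>n. N \<le> n \<Longrightarrow> diameter (range (fwd_comp \<omega> \<sigma> n)) < e"
    by (auto simp: eventually_sequentially)
  have "dist (fwd_comp \<omega> \<sigma> n x) (fwd_comp \<omega> \<sigma> n y) \<le> diameter (range (fwd_comp \<omega> \<sigma> n))" for n x y
    by (rule diameter_bounded_bound)
       (auto intro: bounded_subset[OF compact_imp_bounded[OF X_compact]])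
  with N show ?thesis by (intro that[of N]) (meson le_less_trans)
qed

text \<open>From index \<open>N\<close> on all points lie in the range of the \<open>N\<close>-th
  composition, which is small; compactness gives completeness.\<close>

lemma contracting_convergent:
  assumes "\<sigma> \<in> contracting"
  shows "convergent (\<lambda>n. fwd_comp \<omega> \<sigma> n x)"
proof -
  have "Cauchy (\<lambda>n. fwd_comp \<omega> \<sigma> n x)"
  proof (rule metric_CauchyI)
    fix e :: real assume "0 < e"
    then obtain N where
      N: "\<And>n x y. N \<le> n \<Longrightarrow> dist (fwd_comp \<omega> \<sigma> n x) (fwd_comp \<omega> \<sigma> n y) < e"
      using contracting_dist[OF assms] by metis
    have range: "\<exists>y. fwd_comp \<omega> \<sigma> n x = fwd_comp \<omega> \<sigma> N y" if "N \<le> n" for n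
      using fwd_comp_add[of \<omega> \<sigma> N "n - N" x] that by auto
    then show "\<exists>M. \<forall>m\<ge>M. \<forall>n\<ge>M. dist (fwd_comp \<omega> \<sigma> m x) (fwd_comp \<omega> \<sigma> n x) < e"
      by (metis N le_refl)
  qed
  then show ?thesis
    using compact_imp_complete[OF X_compact] unfolding complete_def convergent_def by auto
qed

text \<open>Almost surely the limit satisfies
  \<open>\<pi> (case_nat l \<sigma>) = \<omega> l (\<pi> \<sigma>)\<close>, and an independent
  letter put in front preserves the law of the sequence; hence the law of \<open>\<pi>\<close> is
  invariant.\<close>

lemma Tp_fixed_exists: "\<exists>\<mu>. Tp_fixed \<omega> p \<mu>"
proof -
  fix x :: 'a
  \<comment> \<open>The constant value off \<open>contracting\<close> makes the sequence converge
    everywhere, so that its limit is measurable.\<close>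
  define u where "u n \<sigma> = (if \<sigma> \<in> contracting then fwd_comp \<omega> \<sigma> n x else x)" for n \<sigma>
  have [measurable]: "contracting \<in> sets (Omega p)" by (fact contracting_measurable)
  have [measurable]: "(\<lambda>\<sigma>. fwd_comp \<omega> \<sigma> n x) \<in> borel_measurable (Omega p)" for n
    by (rule measurable_fwd) simp_all
  have u_meas: "u n \<in> borel_measurable (Omega p)" for n
    unfolding u_def by measurable
  define \<pi> where "\<pi> \<sigma> = lim (\<lambda>n. u n \<sigma>)" for \<sigma>
  have u_lim: "(\<lambda>n. u n \<sigma>) \<longlonglongrightarrow> \<pi> \<sigma>" for \<sigma>
    unfolding \<pi>_def u_def using contracting_convergent[of \<sigma> x]
    by (cases "\<sigma> \<in> contracting") (simp_all add: convergent_LIMSEQ_iff)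
  have \<pi>_meas: "\<pi> \<in> borel_measurable (Omega p)"
    by (rule borel_measurable_LIMSEQ_metric[OF u_meas u_lim])
  have \<pi>_fwd: "(\<lambda>n. fwd_comp \<omega> \<sigma> n x) \<longlonglongrightarrow> \<pi> \<sigma>" if "\<sigma> \<in> contracting" for \<sigma>
    using u_lim[of \<sigma>] that by (simp add: u_def)
  define \<mu> where "\<mu> = distr (Omega p) borel \<pi>"
  have "prob_space \<mu>" unfolding \<mu>_def by (rule P.prob_space_distr[OF \<pi>_meas])
  moreover have sets: "sets \<mu> = sets borel" by (simp add: \<mu>_def)
  moreover have "distr (p \<Otimes>\<^sub>M \<mu>) borel (\<lambda>z. \<omega> (fst z) (snd z)) = \<mu>"
  proof -
    interpret pP: pair_prob_space p "Omega p" ..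
    interpret \<mu>: prob_space \<mu> by fact
    have "p \<Otimes>\<^sub>M \<mu> = distr p p (\<lambda>l. l) \<Otimes>\<^sub>M distr (Omega p) borel \<pi>"
      by (simp add: \<mu>_def)
    also have "\<dots> = distr (p \<Otimes>\<^sub>M Omega p) (p \<Otimes>\<^sub>M borel) (\<lambda>(l, \<sigma>). (l, \<pi> \<sigma>))"
      by (rule pair_measure_distr)
         (use \<pi>_meas \<mu>.sigma_finite_measure_axioms in \<open>simp_all add: \<mu>_def\<close>)
    finally have pair: "p \<Otimes>\<^sub>M \<mu> = distr (p \<Otimes>\<^sub>M Omega p) (p \<Otimes>\<^sub>M borel) (\<lambda>(l, \<sigma>). (l, \<pi> \<sigma>))" .
    have \<pi>_pair: "(\<lambda>(l, \<sigma>). (l, \<pi> \<sigma>)) \<in> measurable (p \<Otimes>\<^sub>M Omega p) (p \<Otimes>\<^sub>M borel)"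
      using \<pi>_meas by measurable
    have "distr (p \<Otimes>\<^sub>M \<mu>) borel (\<lambda>z. \<omega> (fst z) (snd z)) =
        distr (p \<Otimes>\<^sub>M Omega p) borel (\<lambda>z. \<omega> (fst z) (\<pi> (snd z)))"
      unfolding pair
      by (subst distr_distr[OF measurable_map_pair[OF refl] \<pi>_pair]) (simp add: comp_def split_beta')
    also have "\<dots> = distr (p \<Otimes>\<^sub>M Omega p) borel (\<lambda>z. \<pi> (case z of (l, \<sigma>) \<Rightarrow> case_nat l \<sigma>))"
    proof (rule distr_cong_AE[OF refl refl])
      \<comment> \<open>The identity needs both \<open>\<sigma>\<close> and the extended sequence to
        contract; the latter holds almost surely by invariance of the law.\<close>
      have "AE z in p \<Otimes>\<^sub>M Omega p. (case z of (l, \<sigma>) \<Rightarrow> case_nat l \<sigma>) \<in> contracting"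
        using AE_contracting AE_distrD[OF measurable_case_nat, of "\<lambda>\<sigma>. \<sigma> \<in> contracting"]
        unfolding distr_case_nat by blast
      moreover have "AE z in p \<Otimes>\<^sub>M Omega p. snd z \<in> contracting"
        using AE_contracting by (intro pP.AE_pair_measure) (auto intro!: AE_I2)
      ultimately show "AE z in p \<Otimes>\<^sub>M Omega p.
          \<omega> (fst z) (\<pi> (snd z)) = \<pi> (case z of (l, \<sigma>) \<Rightarrow> case_nat l \<sigma>)"
      proof eventually_elim
        case (elim z)
        obtain l \<sigma> where z: "z = (l, \<sigma>)" by fastforce
        have "(\<lambda>n. fwd_comp \<omega> (case_nat l \<sigma>) (Suc n) x) \<longlonglongrightarrow> \<pi> (case_nat l \<sigma>)"
          using \<pi>_fwd elim unfolding z by (intro LIMSEQ_Suc) simp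
        moreover have "(\<lambda>n. fwd_comp \<omega> (case_nat l \<sigma>) (Suc n) x) \<longlonglongrightarrow> \<omega> l (\<pi> \<sigma>)"
          unfolding fwd_comp_Suc_case_nat using \<pi>_fwd elim unfolding z
          by (intro continuous_on_tendsto_compose[OF cont_map]) auto
        ultimately show ?case unfolding z using LIMSEQ_unique by fastforce
      qed
      show "(\<lambda>z. \<pi> (case z of (l, \<sigma>) \<Rightarrow> case_nat l \<sigma>)) \<in> borel_measurable (p \<Otimes>\<^sub>M Omega p)"
        by (rule measurable_compose[OF measurable_case_nat \<pi>_meas])
      show "(\<lambda>z. \<omega> (fst z) (\<pi> (snd z))) \<in> borel_measurable (p \<Otimes>\<^sub>M Omega p)"
        using measurable_compose[OF \<pi>_pair measurable_map_pair[OF refl]] by (simp add: split_beta')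
    qed
    also have "\<dots> = distr (distr (p \<Otimes>\<^sub>M Omega p) (Omega p) (\<lambda>(l, \<sigma>). case_nat l \<sigma>)) borel \<pi>"
      by (subst distr_distr[OF \<pi>_meas measurable_case_nat]) (simp add: comp_def)
    also have "\<dots> = \<mu>" by (simp only: distr_case_nat \<mu>_def)
    finally show ?thesis .
  qed
  ultimately show ?thesis unfolding Tp_fixed_iff_distr by blast
qed

end

section \<open>Orbit averages\<close>

text \<open>The dense sequence and the bound are parameters because compactness only yields their
  existence; \<open>d 0\<close> serves as the base point.\<close>

locale ifs_observable = weakly_hyperbolic_ifs \<omega> p
  for \<omega> :: "'l::metric_space \<Rightarrow> 'a::metric_space \<Rightarrow> 'a" and p :: "'l measure" +
  fixes f :: "'a \<Rightarrow> real" and d :: "nat \<Rightarrow> 'a" and B :: real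
  assumes f_cont: "continuous_on UNIV f"
    and dense: "\<And>x e. 0 < e \<Longrightarrow> \<exists>i. dist x (d i) < e"
    and f_bound: "\<And>x. \<bar>f x\<bar> \<le> B"
begin

text \<open>The supremum runs over a countable dense set so that it is measurable in \<open>\<phi>\<close>.\<close>

definition osc :: "('a \<Rightarrow> 'a) \<Rightarrow> real" where
  "osc \<phi> = (SUP k. \<bar>f (\<phi> (d k)) - f (\<phi> (d 0))\<bar>)"

lemma f_meas [measurable]: "f \<in> borel_measurable borel"
  by (rule borel_measurable_continuous_onI[OF f_cont])

lemma diff_le: "\<bar>f x - f y\<bar> \<le> 2 * B"
  using f_bound[of x] f_bound[of y] by linarith

lemma osc_bdd: "bdd_above (range (\<lambda>k. \<bar>f (\<phi> (d k)) - f (\<phi> (d 0))\<bar>))"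
  by (rule bdd_aboveI[of _ "2 * B"]) (auto simp: diff_le)

lemma osc_leI: "(\<And>x. \<bar>f (\<phi> x) - f (\<phi> (d 0))\<bar> \<le> c) \<Longrightarrow> osc \<phi> \<le> c"
  unfolding osc_def by (rule cSUP_least) auto

lemma osc_nonneg: "0 \<le> osc \<phi>"
  using cSUP_upper[OF UNIV_I osc_bdd, of \<phi> 0] by (simp add: osc_def)

lemma osc_abs_le: "\<bar>osc \<phi>\<bar> \<le> 2 * B"
  using osc_leI[of \<phi> "2 * B"] osc_nonneg[of \<phi>] diff_le by simp

text \<open>The bound holds along the dense sequence by definition and passes to limits by
  continuity of \<open>\<phi>\<close> and \<open>f\<close>.\<close>

lemma diff_le_osc:
  assumes "continuous_on UNIV \<phi>"
  shows "\<bar>f (\<phi> x) - f (\<phi> (d 0))\<bar> \<le> osc \<phi>"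
proof -
  have "\<exists>i. dist x (d i) < inverse (real (Suc n))" for n
    by (rule dense) simp
  then obtain i where i: "\<And>n. dist x (d (i n)) < inverse (real (Suc n))"
    by metis
  have "(\<lambda>n. dist (d (i n)) x) \<longlonglongrightarrow> 0"
    by (rule tendsto_sandwich[OF _ _ tendsto_const LIMSEQ_inverse_real_of_nat])
       (use less_imp_le[OF i] in \<open>simp_all add: dist_commute\<close>)
  then have "(\<lambda>n. d (i n)) \<longlonglongrightarrow> x"
    by (rule tendsto_dist_iff[THEN iffD2])
  then have "(\<lambda>n. f (\<phi> (d (i n)))) \<longlonglongrightarrow> f (\<phi> x)"
    using continuous_on_tendsto_compose[OF continuous_on_compose2[OF f_cont assms]] by auto
  then have "(\<lambda>n. \<bar>f (\<phi> (d (i n))) - f (\<phi> (d 0))\<bar>) \<longlonglongrightarrow> \<bar>f (\<phi> x) - f (\<phi> (d 0))\<bar>"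
    by (intro tendsto_intros)
  then show ?thesis
    by (rule LIMSEQ_le_const2) (auto simp: osc_def intro!: cSUP_upper osc_bdd)
qed

lemma measurable_osc:
  assumes "\<And>x. (\<lambda>s. \<phi> s x) \<in> borel_measurable M"
  shows "(\<lambda>s. osc (\<phi> s)) \<in> borel_measurable M"
proof -
  have [measurable]: "(\<lambda>s. \<phi> s x) \<in> borel_measurable M" for x by (fact assms)
  show ?thesis
    unfolding osc_def by (rule borel_measurable_cSUP) (auto intro: osc_bdd)
qed

lemma measurable_fwd_Omega [measurable]: "(\<lambda>\<sigma>. fwd_comp \<omega> \<sigma> n x) \<in> borel_measurable (Omega p)"
  by (rule measurable_fwd) simp_all

lemma measurable_bwd_Omega [measurable]: "(\<lambda>\<sigma>. bwd_comp \<omega> \<sigma> n x) \<in> borel_measurable (Omega p)"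
  by (rule measurable_bwd) simp_all

lemma measurable_osc_fwd [measurable]: "(\<lambda>\<sigma>. osc (fwd_comp \<omega> \<sigma> n)) \<in> borel_measurable (Omega p)"
  by (rule measurable_osc) simp

lemma osc_fwd_tendsto:
  assumes "\<sigma> \<in> contracting"
  shows "(\<lambda>n. osc (fwd_comp \<omega> \<sigma> n)) \<longlonglongrightarrow> 0"
proof (rule tendstoI)
  fix e :: real assume e: "0 < e"
  have "uniformly_continuous_on UNIV f"
    by (rule compact_uniformly_continuous[OF f_cont X_compact])
  \<comment> \<open>A supremum only inherits a weak inequality, hence the margin
    \<open>e / 2\<close>.\<close>
  then obtain r where r: "0 < r" "\<And>x y. dist x y < r \<Longrightarrow> dist (f x) (f y) < e / 2"
    using e unfolding uniformly_continuous_on_def by (metis UNIV_I half_gt_zero)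
  obtain N where N: "\<And>n x y. N \<le> n \<Longrightarrow> dist (fwd_comp \<omega> \<sigma> n x) (fwd_comp \<omega> \<sigma> n y) < r"
    using contracting_dist[OF assms r(1)] by metis
  have "osc (fwd_comp \<omega> \<sigma> n) \<le> e / 2" if "N \<le> n" for n
    using r(2)[OF N[OF that]] by (intro osc_leI) (auto simp: dist_real_def intro: less_imp_le)
  then show "eventually (\<lambda>n. dist (osc (fwd_comp \<omega> \<sigma> n)) 0 < e) sequentially"
    using e osc_nonneg unfolding eventually_sequentially
    by (intro exI[of _ N]) (fastforce simp: dist_real_def)
qed

lemma expectation_osc_tendsto: "(\<lambda>n. P.expectation (\<lambda>\<sigma>. osc (fwd_comp \<omega> \<sigma> n))) \<longlonglongrightarrow> 0"
proof -
  have "(\<lambda>n. P.expectation (\<lambda>\<sigma>. osc (fwd_comp \<omega> \<sigma> n))) \<longlonglongrightarrow> P.expectation (\<lambda>_. 0)"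
  proof (rule integral_dominated_convergence[where w="\<lambda>_. 2 * B"])
    show "AE \<sigma> in Omega p. (\<lambda>n. osc (fwd_comp \<omega> \<sigma> n)) \<longlonglongrightarrow> 0"
      using AE_contracting by eventually_elim (rule osc_fwd_tendsto)
  qed (auto simp: osc_abs_le)
  then show ?thesis by simp
qed

text \<open>By invariance the integral is the expectation of \<open>H\<close>, the
  \<open>\<mu>\<close>-average of \<open>f\<close> over the \<open>n\<close>-step images. For each
  \<open>\<sigma>\<close> all averaged values lie within the oscillation of the value at the base
  point.\<close>

lemma Tp_fixed_integral_approx:
  assumes "Tp_fixed \<omega> p \<mu>"
  shows "\<bar>P.expectation (\<lambda>\<sigma>. f (fwd_comp \<omega> \<sigma> n (d 0))) - (\<integral>x. f x \<partial>\<mu>)\<bar>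
    \<le> P.expectation (\<lambda>\<sigma>. osc (fwd_comp \<omega> \<sigma> n))"
proof -
  have sets: "sets \<mu> = sets borel" and "prob_space \<mu>"
    using assms by (auto simp: Tp_fixed_def)
  interpret \<mu>: prob_space \<mu> by fact
  define H where "H \<sigma> = (\<integral>x. f (fwd_comp \<omega> \<sigma> n x) \<partial>\<mu>)" for \<sigma>
  have [measurable]: "H \<in> borel_measurable (Omega p)"
    unfolding H_def by (rule measurable_integral_fwd[OF \<open>prob_space \<mu>\<close> sets f_cont])
  have int: "integrable \<mu> (\<lambda>x. f (fwd_comp \<omega> \<sigma> n x))" for \<sigma>
    by (rule integrable_fwd[OF \<open>prob_space \<mu>\<close> sets f_cont])
  have H_close: "\<bar>f (fwd_comp \<omega> \<sigma> n (d 0)) - H \<sigma>\<bar> \<le> osc (fwd_comp \<omega> \<sigma> n)" for \<sigma>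
  proof -
    have "f (fwd_comp \<omega> \<sigma> n (d 0)) - H \<sigma> =
        (\<integral>x. f (fwd_comp \<omega> \<sigma> n (d 0)) - f (fwd_comp \<omega> \<sigma> n x) \<partial>\<mu>)"
      unfolding H_def using int[of \<sigma>]
      by (subst Bochner_Integration.integral_diff) (simp_all add: \<mu>.prob_space)
    then have "\<bar>f (fwd_comp \<omega> \<sigma> n (d 0)) - H \<sigma>\<bar> \<le>
        (\<integral>x. \<bar>f (fwd_comp \<omega> \<sigma> n (d 0)) - f (fwd_comp \<omega> \<sigma> n x)\<bar> \<partial>\<mu>)"
      by (simp add: integral_abs_bound)
    also have "\<dots> \<le> osc (fwd_comp \<omega> \<sigma> n)"
      using int[of \<sigma>] diff_le_osc[OF cont_fwd, of \<sigma> n]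
      by (intro \<mu>.integral_le_const) (auto simp: abs_minus_commute)
    finally show ?thesis .
  qed
  have int_f: "integrable (Omega p) (\<lambda>\<sigma>. f (fwd_comp \<omega> \<sigma> n (d 0)))"
    by (rule P.integrable_const_bound[where B=B]) (auto simp: f_bound)
  have int_osc: "integrable (Omega p) (\<lambda>\<sigma>. osc (fwd_comp \<omega> \<sigma> n))"
    by (rule P.integrable_const_bound[where B="2 * B"]) (auto simp: osc_abs_le)
  have int_H: "integrable (Omega p) H"
  \<comment> \<open>\<open>2 * B\<close> for the oscillation plus \<open>B\<close> for the value at
    the base point.\<close>
  proof (rule P.integrable_const_bound[where B="3 * B"])
    have "\<bar>H \<sigma>\<bar> \<le> 3 * B" for \<sigma>
      using H_close[of \<sigma>] osc_abs_le[of "fwd_comp \<omega> \<sigma> n"] f_bound[of "fwd_comp \<omega> \<sigma> n (d 0)"]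
      by linarith
    then show "AE \<sigma> in Omega p. norm (H \<sigma>) \<le> 3 * B" by simp
  qed simp
  have "(\<integral>x. f x \<partial>\<mu>) = P.expectation H"
    using Tp_fixed_integral_fwd[OF assms f_cont, of n] unfolding H_def .
  then have "\<bar>P.expectation (\<lambda>\<sigma>. f (fwd_comp \<omega> \<sigma> n (d 0))) - (\<integral>x. f x \<partial>\<mu>)\<bar> =
      \<bar>P.expectation (\<lambda>\<sigma>. f (fwd_comp \<omega> \<sigma> n (d 0)) - H \<sigma>)\<bar>"
    using int_f int_H by simp
  also have "\<dots> \<le> P.expectation (\<lambda>\<sigma>. \<bar>f (fwd_comp \<omega> \<sigma> n (d 0)) - H \<sigma>\<bar>)"
    by (rule integral_abs_bound)
  also have "\<dots> \<le> P.expectation (\<lambda>\<sigma>. osc (fwd_comp \<omega> \<sigma> n))"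
    using int_f int_H int_osc H_close by (intro integral_mono) auto
  finally show ?thesis .
qed

text \<open>The sequence does not depend on \<open>\<mu>\<close>, so any two fixed points give
  \<open>f\<close> the same integral.\<close>

lemma Tp_fixed_integral_tendsto:
  assumes "Tp_fixed \<omega> p \<mu>"
  shows "(\<lambda>n. P.expectation (\<lambda>\<sigma>. f (fwd_comp \<omega> \<sigma> n (d 0)))) \<longlonglongrightarrow> (\<integral>x. f x \<partial>\<mu>)"
proof -
  have "(\<lambda>n. P.expectation (\<lambda>\<sigma>. f (fwd_comp \<omega> \<sigma> n (d 0))) - (\<integral>x. f x \<partial>\<mu>)) \<longlonglongrightarrow> 0"
    by (rule Lim_null_comparison[OF _ expectation_osc_tendsto])
       (simp add: Tp_fixed_integral_approx[OF assms])
  then show ?thesis by (simp add: LIM_zero_iff)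
qed

text \<open>A function of the word \<open>\<sigma>\<^sub>i, \<dots>, \<sigma>\<^sub>i\<^sub>+\<^sub>m\<^sub>-\<^sub>1\<close> is independent of its translates by
  multiples of \<open>m\<close>.\<close>

lemma block_average_tendsto:
  fixes G :: "('a \<Rightarrow> 'a) \<Rightarrow> real"
  assumes m: "0 < m"
    and G_meas: "\<And>N (\<phi> :: (nat \<Rightarrow> 'l) \<Rightarrow> 'a \<Rightarrow> 'a). (\<And>x. (\<lambda>s. \<phi> s x) \<in> borel_measurable N) \<Longrightarrow>
      (\<lambda>s. G (\<phi> s)) \<in> borel_measurable N"
    and G_bound: "\<And>\<phi>. \<bar>G \<phi>\<bar> \<le> K"
  shows "AE \<sigma> in Omega p. (\<lambda>n. (\<Sum>i<n. G (bwd_comp \<omega> (\<lambda>k. \<sigma> (i + k)) m)) / real n)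
    \<longlonglongrightarrow> P.expectation (\<lambda>\<sigma>. G (fwd_comp \<omega> \<sigma> m))"
proof (rule P.strong_law_bounded_mod_independent[OF m _ G_bound])
  fix r assume "r < m"
  define L where "L = {i. i mod m = r}"
  define J where "J i = {i..<i + m}" for i :: nat
  have disj: "disjoint_family_on J L"
  proof (unfold disjoint_family_on_def, intro ballI impI)
    fix i j assume ij: "i \<in> L" "j \<in> L" "i \<noteq> j"
    \<comment> \<open>Two members of a residue class differ by a nonzero multiple of
      \<open>m\<close>, so their windows do not meet.\<close>
    have gap: "a + m \<le> b" if "a \<in> L" "b \<in> L" "a < b" for a b
    proof -
      have "m dvd b - a"
        using that by (auto simp: L_def mod_eq_dvd_iff_nat)
      then have "m \<le> b - a" using that by (intro dvd_imp_le) auto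
      then show ?thesis using that by simp
    qed
    show "J i \<inter> J j = {}"
      using gap[of i j] gap[of j i] ij unfolding J_def by (cases "i < j") auto
  qed
  have "P.indep_vars (\<lambda>i. PiM (J i) (\<lambda>_. borel)) (\<lambda>i \<sigma>. restrict (\<lambda>k. \<sigma> k) (J i)) L"
    by (rule P.indep_vars_restrict[OF indep_coordinates _ disj]) simp
  then have "P.indep_vars (\<lambda>_. borel)
      (\<lambda>i \<sigma>. G (bwd_comp \<omega> (\<lambda>k. restrict (\<lambda>k. \<sigma> k) (J i) (i + k)) m)) L"
  proof (rule P.indep_vars_compose2)
    fix i
    show "(\<lambda>\<tau>. G (bwd_comp \<omega> (\<lambda>k. \<tau> (i + k)) m)) \<in> borel_measurable (PiM (J i) (\<lambda>_. borel))"
      by (intro G_meas measurable_bwd measurable_component_singleton) (auto simp: J_def)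
  qed
  moreover have "bwd_comp \<omega> (\<lambda>k. restrict (\<lambda>k. \<sigma> k) (J i) (i + k)) m = bwd_comp \<omega> (\<lambda>k. \<sigma> (i + k)) m"
    for i \<sigma>
    by (rule bwd_comp_cong) (simp add: J_def)
  ultimately show "P.indep_vars (\<lambda>_. borel) (\<lambda>i \<sigma>. G (bwd_comp \<omega> (\<lambda>k. \<sigma> (i + k)) m)) {i. i mod m = r}"
    by (simp add: L_def)
next
  fix i
  have bwd: "(\<lambda>\<sigma>. G (bwd_comp \<omega> \<sigma> m)) \<in> borel_measurable (Omega p)"
    by (rule G_meas) simp
  have fwd: "(\<lambda>\<sigma>. G (fwd_comp \<omega> \<sigma> m)) \<in> borel_measurable (Omega p)"
    by (rule G_meas) simp
  have rev: "bwd_comp \<omega> \<sigma> m = fwd_comp \<omega> (\<lambda>k. \<sigma> (reverse_prefix m k)) m" for \<sigma>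
    by (rule ext) (rule bwd_comp_eq_fwd_comp_reverse)
  \<comment> \<open>Shift invariance removes \<open>i\<close>; reversing the word then exchanges the
    two orders of composition.\<close>
  have "P.expectation (\<lambda>\<sigma>. G (bwd_comp \<omega> (\<lambda>k. \<sigma> (i + k)) m)) = P.expectation (\<lambda>\<sigma>. G (bwd_comp \<omega> \<sigma> m))"
    by (rule integral_Omega_reindex[OF _ bwd]) simp
  also have "\<dots> = P.expectation (\<lambda>\<sigma>. G (fwd_comp \<omega> \<sigma> m))"
    unfolding rev by (rule integral_Omega_reindex[OF inj_reverse_prefix fwd])
  finally show "P.expectation (\<lambda>\<sigma>. G (bwd_comp \<omega> (\<lambda>k. \<sigma> (i + k)) m)) = \<dots>" .
qed

text \<open>For fixed \<open>m\<close> the shifted orbit averages differ from those of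
  \<open>Y\<close> by at most those of \<open>V\<close>. These have almost sure limits
  \<open>a m\<close> and \<open>v m\<close>, where \<open>v m\<close> tends to 0 and bounds the
  distance from \<open>a m\<close> to the integral.\<close>

lemma orbit_average_tendsto:
  assumes \<mu>: "Tp_fixed \<omega> p \<mu>"
  shows "AE \<sigma> in Omega p. (\<lambda>n. (\<Sum>j = 1..n. f (bwd_comp \<omega> \<sigma> j x)) / real n) \<longlonglongrightarrow> (\<integral>y. f y \<partial>\<mu>)"
proof -
  define a where "a m = P.expectation (\<lambda>\<sigma>. f (fwd_comp \<omega> \<sigma> m (d 0)))" for m
  define v where "v m = P.expectation (\<lambda>\<sigma>. osc (fwd_comp \<omega> \<sigma> m))" for m
  define Y where "Y m \<sigma> i = f (bwd_comp \<omega> (\<lambda>k. \<sigma> (i + k)) m (d 0))" for m i and \<sigma> :: "nat \<Rightarrow> 'l"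
  define V where "V m \<sigma> i = osc (bwd_comp \<omega> (\<lambda>k. \<sigma> (i + k)) m)" for m i and \<sigma> :: "nat \<Rightarrow> 'l"
  \<comment> \<open>\<open>Suc m\<close> keeps block lengths positive. All lengths are handled on
    one set of full measure, so that \<open>m\<close> can be chosen depending on
    \<open>e\<close>.\<close>
  have "AE \<sigma> in Omega p. \<forall>m. (\<lambda>n. (\<Sum>i<n. Y (Suc m) \<sigma> i) / real n) \<longlonglongrightarrow> a (Suc m)"
    unfolding AE_all_countable Y_def a_def
    by (intro allI block_average_tendsto[where G="\<lambda>\<phi>. f (\<phi> (d 0))" and K=B] f_bound
          measurable_compose[OF _ f_meas]) auto
  moreover have "AE \<sigma> in Omega p. \<forall>m. (\<lambda>n. (\<Sum>i<n. V (Suc m) \<sigma> i) / real n) \<longlonglongrightarrow> v (Suc m)"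
    unfolding AE_all_countable V_def v_def
    by (intro allI block_average_tendsto[where K="2 * B"] osc_abs_le measurable_osc) auto
  ultimately show ?thesis
  proof eventually_elim
    case (elim \<sigma>)
    define u where "u j = f (bwd_comp \<omega> \<sigma> j x)" for j
    have close: "\<bar>u (i + m) - Y m \<sigma> i\<bar> \<le> V m \<sigma> i" for i m
      unfolding u_def Y_def V_def bwd_comp_add by (rule diff_le_osc[OF cont_bwd])
    show ?case
    proof (rule tendstoI)
      fix e :: real assume e: "0 < e"
      have "(\<lambda>m. v (Suc m)) \<longlonglongrightarrow> 0"
        using LIMSEQ_Suc[OF expectation_osc_tendsto] unfolding v_def .
      \<comment> \<open>The errors total less than \<open>5 * e / 8\<close>: one part for the shift,
        two for replacing the orbit by \<open>Y\<close> (\<open>v m\<close> and the convergence of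
        \<open>V\<close>), one for the convergence of \<open>Y\<close>, one for
        \<open>a m\<close>.\<close>
      then have "eventually (\<lambda>m. v (Suc m) < e / 8) sequentially"
        using e by (intro order_tendstoD) auto
      then obtain m' where m': "v (Suc m') < e / 8"
        by (auto simp: eventually_sequentially)
      define m where "m = Suc m'"
      have a: "\<bar>a m - (\<integral>y. f y \<partial>\<mu>)\<bar> < e / 8"
        using Tp_fixed_integral_approx[OF \<mu>, of m] m' unfolding a_def v_def m_def by linarith
      have "eventually (\<lambda>n. dist ((\<Sum>i<n. Y m \<sigma> i) / real n) (a m) < e / 8) sequentially"
        using elim(1) e unfolding m_def by (intro tendstoD) auto
      moreover have "eventually (\<lambda>n. dist ((\<Sum>i<n. V m \<sigma> i) / real n) (v m) < e / 8) sequentially"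
        using elim(2) e unfolding m_def by (intro tendstoD) auto
      moreover have "eventually (\<lambda>n. dist ((\<Sum>j = 1..n. u j) / real n - (\<Sum>i<n. u (i + m)) / real n) 0 < e / 8)
          sequentially"
        using e by (intro tendstoD average_shift_diff_tendsto[where K=B]) (auto simp: u_def f_bound)
      ultimately show "eventually (\<lambda>n. dist ((\<Sum>j = 1..n. f (bwd_comp \<omega> \<sigma> j x)) / real n) (\<integral>y. f y \<partial>\<mu>) < e)
          sequentially"
      proof eventually_elim
        case (elim n)
        have "\<bar>(\<Sum>i<n. u (i + m)) - (\<Sum>i<n. Y m \<sigma> i)\<bar> \<le> (\<Sum>i<n. \<bar>u (i + m) - Y m \<sigma> i\<bar>)"
          unfolding sum_subtractf[symmetric] by (rule sum_abs)
        also have "\<dots> \<le> (\<Sum>i<n. V m \<sigma> i)"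
          by (intro sum_mono close)
        finally have "\<bar>(\<Sum>i<n. u (i + m)) / real n - (\<Sum>i<n. Y m \<sigma> i) / real n\<bar> \<le> (\<Sum>i<n. V m \<sigma> i) / real n"
          by (simp add: divide_right_mono flip: diff_divide_distrib)
        then show ?case
          using elim a m' e unfolding u_def[symmetric] m_def[symmetric] dist_real_def by linarith
      qed
    qed
  qed
qed

end

section \<open>Uniqueness of the fixed point and the ergodic theorem\<close>

context weakly_hyperbolic_ifs
begin

text \<open>Existence and uniqueness make the definite description in \<open>mu_p\<close>
  meaningful. Uniqueness holds because integrals of continuous functions determine the
  measure.\<close>

lemma Tp_fixed_mu_p: "Tp_fixed \<omega> p (mu_p \<omega> p)"
proof -
  obtain d :: "nat \<Rightarrow> 'a" where d: "\<And>x e. 0 < e \<Longrightarrow> \<exists>i. dist x (d i) < e"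
    using compact_UNIV_dense_sequence[OF X_compact] by blast
  have "\<mu> = \<nu>" if \<mu>: "Tp_fixed \<omega> p \<mu>" and \<nu>: "Tp_fixed \<omega> p \<nu>" for \<mu> \<nu>
  proof (rule borel_prob_eqI_continuous_integrals)
    show "prob_space \<mu>" "sets \<mu> = sets borel" "prob_space \<nu>" "sets \<nu> = sets borel"
      using \<mu> \<nu> by (auto simp: Tp_fixed_def)
    fix f :: "'a \<Rightarrow> real" assume f: "continuous_on UNIV f" and bound: "\<And>x. \<bar>f x\<bar> \<le> 1"
    interpret ifs_observable \<omega> p f d 1
      by unfold_locales (fact f d bound)+
    show "(\<integral>x. f x \<partial>\<mu>) = (\<integral>x. f x \<partial>\<nu>)"
      using Tp_fixed_integral_tendsto[OF \<mu>] Tp_fixed_integral_tendsto[OF \<nu>] by (rule LIMSEQ_unique)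
  qed
  then show ?thesis
    unfolding mu_p_def using Tp_fixed_exists by (metis theI)
qed

end

theorem theorem2:
  fixes \<omega> :: "'l::metric_space \<Rightarrow> 'a::metric_space \<Rightarrow> 'a"
    and p :: "'l measure"
  assumes X_compact: "compact (UNIV :: 'a set)"
    and Lambda_compact: "compact (UNIV :: 'l set)"
    and \<omega>_cont: "continuous_on UNIV (\<lambda>(l, x). \<omega> l x)"
    and p_prob: "prob_space p"
    and p_borel: "sets p = sets borel"
    and weakly_hyperbolic:
      "emeasure (Omega p) {\<sigma> \<in> space (Omega p).
          (\<lambda>n. diameter (range (fwd_comp \<omega> \<sigma> n))) \<longlonglongrightarrow> 0} = 1"
  shows "\<forall>f :: 'a \<Rightarrow> real. \<forall>x. continuous_on UNIV f \<longrightarrow>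
           (AE \<sigma> in Omega p.
              (\<lambda>n. (\<Sum>j = 1..n. f (bwd_comp \<omega> \<sigma> j x)) / real n)
                \<longlonglongrightarrow> (\<integral>y. f y \<partial>(mu_p \<omega> p)))"
proof (intro allI impI)
  fix f :: "'a \<Rightarrow> real" and x :: 'a
  assume f: "continuous_on UNIV f"
  interpret weakly_hyperbolic_ifs \<omega> p
    by (rule weakly_hyperbolic_ifs.intro) fact+
  obtain d :: "nat \<Rightarrow> 'a" where d: "\<And>x e. 0 < e \<Longrightarrow> \<exists>i. dist x (d i) < e"
    using compact_UNIV_dense_sequence[OF X_compact] by blast
  obtain B where B: "\<And>x. \<bar>f x\<bar> \<le> B" using continuous_bounded[OF f] by blast
  interpret ifs_observable \<omega> p f d B
    by unfold_locales (fact f d B)+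
  show "AE \<sigma> in Omega p. (\<lambda>n. (\<Sum>j = 1..n. f (bwd_comp \<omega> \<sigma> j x)) / real n)
      \<longlonglongrightarrow> (\<integral>y. f y \<partial>(mu_p \<omega> p))"
    by (rule orbit_average_tendsto[OF Tp_fixed_mu_p])
qed

end
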